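(* For any integer $k\geq 2$, if $n\geq 5k-6$ is an integer, then for every (proper) $n$-edge-coloring of the complete bipartite graph $K_{k,n}$ there is a multicolored $2k$-cycle $C_{2k}$ in $K_{k,n}$.
   Context: A (proper) $n$-edge-coloring of a graph $G$ is a mapping from $E(G)$ into a set of $n$ colors such that any two edges sharing a vertex receive distinct colors. A subgraph of an edge-colored graph is multicolored if no two of its edges have the same color. $K_{k,n}$ is the complete bipartite graph with partite sets of sizes $k$ and $n$, and $C_{2k}$ is the cycle of length $2k$. *)

theory Defs
  imports Main
begin

text \<open>Undirected graphs without parallel edges; an edge is the set of its endpoints.\<close>

record 'a ugraph =
  verts :: "'a set"
  edges :: "'a set set"

definition subgraph :: "'a ugraph \<Rightarrow> 'a ugraph \<Rightarrow> bool" where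
  "subgraph H G \<longleftrightarrow> verts H \<subseteq> verts G \<and> edges H \<subseteq> edges G"

text \<open>\<open>complete_bipartite k n G\<close>: the graph \<open>G\<close> is a copy of \<open>K\<^sub>k\<^sub>,\<^sub>n\<close>, on arbitrary vertices.\<close>

definition complete_bipartite :: "nat \<Rightarrow> nat \<Rightarrow> 'a ugraph \<Rightarrow> bool" where
  "complete_bipartite k n G \<longleftrightarrow>
     (\<exists>X Y. finite X \<and> finite Y \<and> X \<inter> Y = {} \<and> card X = k \<and> card Y = n \<and>
        verts G = X \<union> Y \<and> edges G = {{x, y} | x y. x \<in> X \<and> y \<in> Y})"

text \<open>\<open>cycle_graph m H\<close>: the graph \<open>H\<close> is a copy of \<open>C\<^sub>m\<close>; the list \<open>vs\<close> runs once
  around the cycle.\<close>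

definition cycle_graph :: "nat \<Rightarrow> 'a ugraph \<Rightarrow> bool" where
  "cycle_graph m H \<longleftrightarrow> m \<ge> 3 \<and>
     (\<exists>vs. length vs = m \<and> distinct vs \<and> verts H = set vs \<and>
        edges H = {{vs ! i, vs ! (Suc i mod m)} | i. i < m})"

text \<open>The \<open>n\<close> colors need not all be used. Values of \<open>c\<close> outside the edge set are
  irrelevant.\<close>

definition proper_edge_coloring :: "nat \<Rightarrow> 'a ugraph \<Rightarrow> ('a set \<Rightarrow> 'c) \<Rightarrow> bool" where
  "proper_edge_coloring n G c \<longleftrightarrow>
     (\<exists>C. finite C \<and> card C = n \<and> c ` edges G \<subseteq> C) \<and>
     (\<forall>e \<in> edges G. \<forall>f \<in> edges G. e \<noteq> f \<and> e \<inter> f \<noteq> {} \<longrightarrow> c e \<noteq> c f)"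

definition multicolored :: "('a set \<Rightarrow> 'c) \<Rightarrow> 'a ugraph \<Rightarrow> bool" where
  "multicolored c H \<longleftrightarrow> inj_on c (edges H)"

end

theory Submission
  imports Defs
begin

text \<open>
  The cycle is found greedily. Let \<open>x\<^sub>0, \<dots>, x\<^bsub>k-1\<^esub>\<close> be the vertices of the small side, taken
  cyclically in an arbitrary order; a \<open>2k\<close>-cycle is then the choice of distinct
  vertices \<open>y\<^sub>0, \<dots>, y\<^bsub>k-1\<^esub>\<close> of the large side, where \<open>y\<^sub>i\<close> joins \<open>x\<^sub>i\<close> to \<open>x\<^bsub>i+1\<^esub>\<close>. When
  \<open>y\<^sub>m\<close> is to be chosen, \<open>m\<close> vertices and \<open>2m\<close> colours are in use. As a colour occurs at most
  once at each \<open>x\<^sub>i\<close>, at most \<open>m + 2m + 2m = 5m\<close> vertices are forbidden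
  (\<open>exists_avoiding_two_colour_sets\<close>), and \<open>5m \<le> 5(k - 2) < n\<close> until the last step.

  In the last step, \<open>m = k - 1\<close>, this count gives only \<open>5k - 5\<close>, but it can be lowered by two.
  Each of the two ends \<open>x\<^bsub>k-1\<^esub>\<close> and \<open>x\<^sub>0\<close> of the path already carries an edge of the path. The
  colour of that edge is in use, but the only vertex it forbids at this end is the other endpoint
  of the edge, which has already been counted as a vertex in use. So at most \<open>5k - 7 < n\<close> vertices
  are forbidden.
\<close>

section \<open>Greedy choice of a rainbow closed walk\<close>

lemma exists_avoiding_two_colour_sets:
  assumes "finite S" "finite A" "finite B"
    and "inj_on f Y" "inj_on g Y"
    and "card S + card A + card B < card Y"
  obtains z where "z \<in> Y" "z \<notin> S" "f z \<notin> A" "g z \<notin> B"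
proof -
  define bad where "bad = S \<union> (f -` A \<inter> Y) \<union> (g -` B \<inter> Y)"
  have "card (f -` A \<inter> Y) \<le> card A" "card (g -` B \<inter> Y) \<le> card B"
    using assms by (auto intro: card_vimage_inj_on_le)
  moreover have "card bad \<le> card S + card (f -` A \<inter> Y) + card (g -` B \<inter> Y)"
    unfolding bad_def by (meson add_le_mono card_Un_le le_refl le_trans)
  ultimately have "card bad < card Y"
    using assms(6) by linarith
  moreover have "finite bad"
    unfolding bad_def using assms by (auto intro: finite_vimage_IntI)
  ultimately have "\<not> Y \<subseteq> bad"
    using card_mono leD by blast
  then show thesis
    using that unfolding bad_def by blast
qed

text \<open>In the next two definitions \<open>col i v\<close> is the colour of the edge between \<open>x\<^sub>i\<close> and \<open>v\<close>. The
  walk \<open>x\<^sub>0, y\<^sub>0, x\<^sub>1, y\<^sub>1, \<dots>\<close> has the edges \<open>x\<^sub>i y\<^sub>i\<close> at the even positions \<open>2i\<close> and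
  \<open>y\<^sub>i x\<^bsub>i+1\<^esub>\<close> at the odd positions \<open>2i + 1\<close>; both cases are one formula.\<close>

definition walk_colour :: "(nat \<Rightarrow> 'a \<Rightarrow> 'c) \<Rightarrow> (nat \<Rightarrow> 'a) \<Rightarrow> nat \<Rightarrow> 'c" where
  "walk_colour col y j = col (Suc j div 2) (y (j div 2))"

definition rainbow_walk ::
    "'a set \<Rightarrow> (nat \<Rightarrow> 'a \<Rightarrow> 'c) \<Rightarrow> nat \<Rightarrow> (nat \<Rightarrow> 'a) \<Rightarrow> bool" where
  "rainbow_walk Y col m y \<longleftrightarrow>
     y ` {..<m} \<subseteq> Y \<and> inj_on y {..<m} \<and> inj_on (walk_colour col y) {..<2 * m}"

lemma rainbow_walk_extend:
  assumes walk: "rainbow_walk Y col m y"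
    and z: "z \<in> Y" "z \<notin> y ` {..<m}"
    and new: "col m z \<notin> walk_colour col y ` {..<2 * m}"
      "col (Suc m) z \<notin> walk_colour col y ` {..<2 * m}"
    and ne: "col m z \<noteq> col (Suc m) z"
  shows "rainbow_walk Y col (Suc m) (y(m := z))"
proof -
  let ?y = "y(m := z)"
  have old: "walk_colour col ?y j = walk_colour col y j" if "j < 2 * m" for j
    using that by (auto simp: walk_colour_def)
  then have img: "walk_colour col ?y ` {..<2 * m} = walk_colour col y ` {..<2 * m}"
    by auto
  have inj: "inj_on (walk_colour col ?y) {..<2 * m}"
    using walk old by (auto simp: rainbow_walk_def inj_on_def)
  have last: "walk_colour col ?y (2 * m) = col m z"
    "walk_colour col ?y (Suc (2 * m)) = col (Suc m) z"
    by (auto simp: walk_colour_def)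
  have "inj_on (walk_colour col ?y) (insert (Suc (2 * m)) (insert (2 * m) {..<2 * m}))"
    using inj img last new ne by (auto simp: inj_on_insert)
  moreover have "{..<2 * Suc m} = insert (Suc (2 * m)) (insert (2 * m) {..<2 * m})"
    by auto
  moreover have "inj_on ?y {..<Suc m}"
    using walk z by (auto simp: rainbow_walk_def inj_on_def less_Suc_eq)
  moreover have "?y ` {..<Suc m} \<subseteq> Y"
    using walk z by (auto simp: rainbow_walk_def less_Suc_eq)
  ultimately show ?thesis
    by (simp add: rainbow_walk_def)
qed

text \<open>The step from \<open>m\<close> to \<open>m + 1\<close> needs \<open>5m < |Y|\<close>; for the last step, \<open>m = l - 1\<close>, this is
  \<open>5l \<le> |Y| + 4\<close>.\<close>

lemma exists_rainbow_walk:
  assumes inj: "\<And>i. inj_on (col i) Y"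
    and ne: "\<And>i v. v \<in> Y \<Longrightarrow> col i v \<noteq> col (Suc i) v"
    and "5 * l \<le> card Y + 4"
  shows "\<exists>y. rainbow_walk Y col l y"
  using assms(3)
proof (induction l)
  case 0
  show ?case
    by (simp add: rainbow_walk_def)
next
  case (Suc m)
  then obtain y where y: "rainbow_walk Y col m y"
    by auto
  let ?C = "walk_colour col y ` {..<2 * m}"
  have "card ?C \<le> 2 * m" "card (y ` {..<m}) \<le> m"
    using card_image_le[of "{..<2 * m}" "walk_colour col y"] card_image_le[of "{..<m}" y]
    by auto
  then have count: "card (y ` {..<m}) + card ?C + card ?C < card Y"
    using Suc.prems by simp
  have "finite (y ` {..<m})" "finite ?C"
    by auto
  then obtain z where "z \<in> Y" "z \<notin> y ` {..<m}" "col m z \<notin> ?C" "col (Suc m) z \<notin> ?C"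
    using exists_avoiding_two_colour_sets[OF _ _ _ inj inj count] by blast
  then show ?case
    using rainbow_walk_extend[OF y] ne by blast
qed

text \<open>The hypothesis \<open>col k = col 0\<close> says that the walk returns to \<open>x\<^sub>0\<close>.\<close>

lemma exists_rainbow_closed_walk:
  assumes inj: "\<And>i. inj_on (col i) Y"
    and ne: "\<And>i v. v \<in> Y \<Longrightarrow> col i v \<noteq> col (Suc i) v"
    and closed: "col k = col 0"
    and k: "k \<ge> 2"
    and card: "card Y \<ge> 5 * k - 6"
  shows "\<exists>y. rainbow_walk Y col k y"
proof -
  obtain l where l: "k = Suc (Suc l)"
    using k by (metis add_2_eq_Suc le_Suc_ex)
  define m where "m = Suc l"
  have "5 * m \<le> card Y + 4"
    using card l m_def by simp
  then obtain y where y: "rainbow_walk Y col m y"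
    using exists_rainbow_walk[of col Y m] inj ne by blast
  let ?C = "walk_colour col y ` {..<2 * m}"
  have card_le: "card ?C \<le> 2 * m" "card (y ` {..<m}) \<le> m"
    using card_image_le[of "{..<2 * m}" "walk_colour col y"] card_image_le[of "{..<m}" y]
    by auto
  \<comment> \<open>The colours of the last and of the first edge of the walk: at its own end of the walk, each
    of them forbids only a vertex that is already in use.\<close>
  let ?a = "col m (y l)" and ?b = "col (Suc m) (y 0)"
  have "walk_colour col y (Suc (2 * l)) = ?a"
    by (simp add: walk_colour_def m_def)
  then have a: "?a \<in> ?C"
    unfolding m_def by (auto intro: image_eqI[of _ _ "Suc (2 * l)"])
  have "walk_colour col y 0 = ?b"
    using closed by (simp add: walk_colour_def m_def l)
  then have b: "?b \<in> ?C"
    unfolding m_def by (auto intro: image_eqI[of _ _ 0])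
  have "card (y ` {..<m}) + card (?C - {?a}) + card (?C - {?b}) < card Y"
    using card_le a b card l by (simp add: m_def)
  moreover have "finite (y ` {..<m})" "finite (?C - {?a})" "finite (?C - {?b})"
    by auto
  ultimately obtain z where z: "z \<in> Y" "z \<notin> y ` {..<m}"
    and col: "col m z \<notin> ?C - {?a}" "col (Suc m) z \<notin> ?C - {?b}"
    using exists_avoiding_two_colour_sets[OF _ _ _ inj inj] by blast
  have "y l \<in> Y" "y 0 \<in> Y" "z \<noteq> y l" "z \<noteq> y 0"
    using y z by (auto simp: rainbow_walk_def m_def)
  then have "col m z \<noteq> ?a" "col (Suc m) z \<noteq> ?b"
    using inj z(1) by (auto dest: inj_onD)
  then have "rainbow_walk Y col (Suc m) (y(m := z))"
    using rainbow_walk_extend[OF y] z col ne by blast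
  then show ?thesis
    using l m_def by blast
qed

section \<open>From the closed walk to the cycle\<close>

theorem theorem3:
  fixes k n :: nat and G :: "'a ugraph" and c :: "'a set \<Rightarrow> 'c"
  assumes "k \<ge> 2" and "n \<ge> 5 * k - 6"
    and "complete_bipartite k n G"
    and "proper_edge_coloring n G c"
  shows "\<exists>H. subgraph H G \<and> cycle_graph (2 * k) H \<and> multicolored c H"
proof -
  obtain X Y where fin: "finite X" "finite Y" and disj: "X \<inter> Y = {}"
    and card: "card X = k" "card Y = n" and vG: "verts G = X \<union> Y"
    and eG: "edges G = {{x, y} | x y. x \<in> X \<and> y \<in> Y}"
    using assms(3) unfolding complete_bipartite_def by blast
  have proper: "c e \<noteq> c f" if "e \<in> edges G" "f \<in> edges G" "e \<noteq> f" "e \<inter> f \<noteq> {}" for e f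
    using assms(4) that unfolding proper_edge_coloring_def by blast
  obtain h where h: "bij_betw h {..<k} X"
    using ex_bij_betw_nat_finite[OF fin(1)] card by (auto simp: lessThan_atLeast0)
  define x where "x i = h (i mod k)" for i
  have xX: "x i \<in> X" for i
    unfolding x_def using h assms(1) by (auto dest: bij_betwE)
  have x_inj: "inj_on x {..<k}"
    using h by (auto simp: x_def bij_betw_def inj_on_def)
  have x_Suc: "x i \<noteq> x (Suc i)" for i
  proof
    assume "x i = x (Suc i)"
    then have "i mod k = Suc i mod k"
      using h assms(1) unfolding x_def bij_betw_def by (auto dest: inj_onD)
    then show False
      using assms(1) by (simp add: mod_Suc split: if_splits)
  qed
  have edge: "{x i, v} \<in> edges G" if "v \<in> Y" for i v
    using xX that unfolding eG by blast
  define col where "col i v = c {x i, v}" for i v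
  have "inj_on (col i) Y" for i
  proof (rule inj_onI)
    fix v w assume vw: "v \<in> Y" "w \<in> Y" "col i v = col i w"
    show "v = w"
    proof (rule ccontr)
      assume "v \<noteq> w"
      then have "{x i, v} \<noteq> {x i, w}"
        by (auto simp: doubleton_eq_iff)
      then show False
        using proper[of "{x i, v}" "{x i, w}"] edge vw by (auto simp: col_def)
    qed
  qed
  moreover have "col i v \<noteq> col (Suc i) v" if "v \<in> Y" for i v
  proof -
    have "{x i, v} \<noteq> {x (Suc i), v}"
      using x_Suc by (auto simp: doubleton_eq_iff)
    then show ?thesis
      using proper[of "{x i, v}" "{x (Suc i), v}"] edge that by (auto simp: col_def)
  qed
  moreover have "col k = col 0"
    by (auto simp: col_def x_def)
  ultimately obtain y where "rainbow_walk Y col k y"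
    using exists_rainbow_closed_walk[of col Y k] assms(1,2) card by blast
  then have y_sub: "y ` {..<k} \<subseteq> Y" and y_inj: "inj_on y {..<k}"
    and rainbow: "inj_on (walk_colour col y) {..<2 * k}"
    unfolding rainbow_walk_def by blast+
  have yY: "y i \<in> Y" if "i < k" for i
    using y_sub that by blast

  define w where "w j = (if even j then x (j div 2) else y (j div 2))" for j
  define vs where "vs = map w [0..<2 * k]"
  define E where "E j = {x (Suc j div 2), y (j div 2)}" for j
  define H where "H = \<lparr>verts = set vs, edges = E ` {..<2 * k}\<rparr>"
  have x_ne_y: "x i \<noteq> y j" if "j < k" for i j
    using xX yY[OF that] disj by (metis disjoint_iff)
  have w_inj: "inj_on w {..<2 * k}"
  proof (rule inj_onI)
    fix i j assume "i \<in> {..<2 * k}" "j \<in> {..<2 * k}" and eq: "w i = w j"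
    then have lt: "i div 2 < k" "j div 2 < k"
      by auto
    then have "even i = even j"
      using eq x_ne_y x_ne_y[symmetric] by (auto simp: w_def split: if_splits)
    moreover from this have "i div 2 = j div 2"
      using eq lt x_inj y_inj by (auto simp: w_def dest: inj_onD split: if_splits)
    ultimately show "i = j"
      by presburger
  qed
  have w_edge: "{w j, w (Suc j mod (2 * k))} = E j" if "j < 2 * k" for j
  proof (cases "even j")
    case True
    then have "Suc j < 2 * k"
      using that by presburger
    then show ?thesis
      using True by (auto simp: w_def E_def)
  next
    case False
    have "w (Suc j mod (2 * k)) = x (Suc j div 2)"
    proof (cases "Suc j = 2 * k")
      case True
      then show ?thesis
        by (simp add: w_def x_def)
    next
      case False
      then show ?thesis
        using that \<open>odd j\<close> by (simp add: w_def)
    qed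
    then show ?thesis
      using False by (auto simp: w_def E_def)
  qed
  have "cycle_graph (2 * k) H"
  proof -
    have "distinct vs"
      using w_inj by (simp add: vs_def distinct_map lessThan_atLeast0)
    moreover have "edges H = {{vs ! i, vs ! (Suc i mod (2 * k))} | i. i < 2 * k}"
    proof -
      have "{vs ! i, vs ! (Suc i mod (2 * k))} = E i" if "i < 2 * k" for i
        using w_edge[OF that] that by (simp add: vs_def)
      then show ?thesis
        unfolding H_def by (auto simp: image_def)
    qed
    ultimately show ?thesis
      unfolding cycle_graph_def using assms(1)
      by (intro conjI exI[of _ vs]) (auto simp: H_def vs_def)
  qed
  moreover have "subgraph H G"
  proof -
    have "w ` {..<2 * k} \<subseteq> verts G" "E ` {..<2 * k} \<subseteq> edges G"
      using xX yY edge by (auto simp: w_def E_def vG)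
    then show ?thesis
      by (simp add: subgraph_def H_def vs_def lessThan_atLeast0)
  qed
  moreover have "multicolored c H"
  proof -
    have "walk_colour col y = c \<circ> E"
      by (auto simp: walk_colour_def col_def E_def)
    then show ?thesis
      using rainbow by (auto simp: multicolored_def H_def intro: inj_on_imageI)
  qed
  ultimately show ?thesis
    by blast
qed

end
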